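(* Let $w$ be a string of length $n$ and run algorithm findmaxr on $(w, ml)$ with $ml=1$. Then every reported string is a maximal repeat of $w$, the reported positions $r[p_i],\dots,r[n_i]$ are exactly all of its occurrences in $w$, every maximal repeat of $w$ is reported, and the maximal repeats are reported in non-decreasing order of length.
   Context: Positions of $w$ are numbered $1,\dots,n$; $w[i..j]$ denotes the substring from position $i$ to $j$ inclusive (substrings are nonempty). A string $u$ occurs in $w$ at position $i$ if $u=w[i..i+|u|-1]$. An extension of $u$ is any string having $u$ as a proper substring. A maximal repeat of $w$ is a string that occurs more than once in $w$ and each of whose extensions occurs fewer times in $w$. The suffix array $r$ of $w$ is the permutation of $\{1,\dots,n\}$ with $w[r[i]..n]$ lexicographically smaller than $w[r[j]..n]$ whenever $i<j$; $p$ is its inverse ($p[r[i]]=i$); for $1\le i<n$, $LCP[i]$ is the length of the longest common prefix of $w[r[i]..n]$ and $w[r[i+1]..n]$. Algorithm findmaxr$(w,ml)$: compute $r$, $p$, $LCP$. Let $S:=\{t\in\{1,\dots,n-1\}: LCP[t]<ml\}\cup\{0,n\}$. Process the indices $t\in\{1,\dots,n-1\}$ with $LCP[t]\ge ml$ one at a time in non-decreasing order of $LCP[t]$. For the current index $i$: set $p_i:=\max\{j\in S: j<i\}+1$ and $n_i:=\min\{j\in S: j>i\}$, then insert $i$ into $S$. If ($p_i=1$ or $LCP[p_i-1]\neq LCP[i]$) and ($n_i=n$ or $LCP[n_i]\neq LCP[i]$), and moreover ($r[p_i]=1$ or $r[n_i]=1$ or $w[r[p_i]-1]\neq w[r[n_i]-1]$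 or $p[r[n_i]-1]-p[r[p_i]-1]\neq n_i-p_i$), then report the string $w[r[i]..r[i]+LCP[i]-1]$ together with its $n_i-p_i+1$ positions $r[p_i],r[p_i+1],\dots,r[n_i]$. *)

theory Defs
  imports "HOL-Library.Sublist" "HOL-Library.List_Lexorder"
begin

text \<open>
  Positions are numbered from 1, as opposed to the 0-based \<^const>\<open>nth\<close>: position \<open>i\<close> of \<open>w\<close>
  carries the letter \<open>w ! (i - 1)\<close>.  The order on strings is the lexicographic one of
  \<open>List_Lexorder\<close>, in which a proper prefix is smaller.
\<close>

definition letter :: "'a list \<Rightarrow> nat \<Rightarrow> 'a" where
  "letter w i = w ! (i - 1)"

definition substr :: "'a list \<Rightarrow> nat \<Rightarrow> nat \<Rightarrow> 'a list" where
  "substr w i j = map (letter w) [i..<Suc j]"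

text \<open>Substrings are nonempty, so the empty string occurs nowhere and is never a repeat.\<close>

definition occurs_at :: "'a list \<Rightarrow> 'a list \<Rightarrow> nat \<Rightarrow> bool" where
  "occurs_at w u i \<longleftrightarrow>
     u \<noteq> [] \<and> 1 \<le> i \<and> i + length u - 1 \<le> length w \<and> u = substr w i (i + length u - 1)"

definition occurrences :: "'a list \<Rightarrow> 'a list \<Rightarrow> nat set" where
  "occurrences w u = {i. occurs_at w u i}"

definition extension :: "'a list \<Rightarrow> 'a list \<Rightarrow> bool" where
  "extension v u \<longleftrightarrow> u \<noteq> [] \<and> strict_sublist u v"

definition maximal_repeat :: "'a list \<Rightarrow> 'a list \<Rightarrow> bool" where
  "maximal_repeat w u \<longleftrightarrow>
     1 < card (occurrences w u) \<and>
     (\<forall>v. extension v u \<longrightarrow> card (occurrences w v) < card (occurrences w u))"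

text \<open>The values of \<open>r\<close> outside \<open>{1..length w}\<close> are irrelevant.\<close>

definition suffix_array :: "'a::linorder list \<Rightarrow> (nat \<Rightarrow> nat) \<Rightarrow> bool" where
  "suffix_array w r \<longleftrightarrow>
     bij_betw r {1..length w} {1..length w} \<and>
     (\<forall>i\<in>{1..length w}. \<forall>j\<in>{1..length w}. i < j \<longrightarrow>
        substr w (r i) (length w) < substr w (r j) (length w))"

definition inverse_array :: "'a list \<Rightarrow> (nat \<Rightarrow> nat) \<Rightarrow> nat \<Rightarrow> nat" where
  "inverse_array w r = inv_into {1..length w} r"

definition LCP :: "'a list \<Rightarrow> (nat \<Rightarrow> nat) \<Rightarrow> nat \<Rightarrow> nat" where
  "LCP w r i =
     length (Longest_common_prefix
       {substr w (r i) (length w), substr w (r (i + 1)) (length w)})"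

text \<open>
  The test made at an index whose neighbours are \<open>a = p\<^sub>i\<close> and \<open>b = n\<^sub>i\<close>.  The difference of ranks
  is taken in \<open>int\<close>, because subtraction on \<open>nat\<close> truncates.
\<close>

definition reportable :: "'a list \<Rightarrow> (nat \<Rightarrow> nat) \<Rightarrow> nat \<Rightarrow> nat \<Rightarrow> nat \<Rightarrow> bool" where
  "reportable w r i a b \<longleftrightarrow>
     (a = 1 \<or> LCP w r (a - 1) \<noteq> LCP w r i) \<and>
     (b = length w \<or> LCP w r b \<noteq> LCP w r i) \<and>
     (r a = 1 \<or> r b = 1 \<or>
      letter w (r a - 1) \<noteq> letter w (r b - 1) \<or>
      int (inverse_array w r (r b - 1)) - int (inverse_array w r (r a - 1)) \<noteq> int b - int a)"

text \<open>
  The main loop.  The set \<open>S\<close> is the state, the last argument lists the indices still to be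
  processed, and the result lists the reports (string, positions) in the order in which they are
  made.
\<close>

primrec findmaxr_loop ::
  "'a list \<Rightarrow> (nat \<Rightarrow> nat) \<Rightarrow> nat set \<Rightarrow> nat list \<Rightarrow> ('a list \<times> nat list) list" where
  "findmaxr_loop w r S [] = []"
| "findmaxr_loop w r S (i # is) =
     (let a = Max {j \<in> S. j < i} + 1;
          b = Min {j \<in> S. i < j}
      in (if reportable w r i a b
          then [(substr w (r i) (r i + LCP w r i - 1), map r [a..<Suc b])] else [])
         @ findmaxr_loop w r (insert i S) is)"

definition processing_order ::
  "'a list \<Rightarrow> nat \<Rightarrow> (nat \<Rightarrow> nat) \<Rightarrow> nat list \<Rightarrow> bool" where
  "processing_order w ml r is \<longleftrightarrow>
     distinct is \<and> set is = {t \<in> {1..<length w}. ml \<le> LCP w r t} \<and> sorted (map (LCP w r) is)"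

text \<open>
  \<open>findmaxr w ml out\<close>: some run of the algorithm on \<open>(w, ml)\<close> makes the reports \<open>out\<close>.  This is a
  relation, because the order among indices with equal LCP values is left open.
\<close>

definition findmaxr :: "'a::linorder list \<Rightarrow> nat \<Rightarrow> ('a list \<times> nat list) list \<Rightarrow> bool" where
  "findmaxr w ml out \<longleftrightarrow>
     (\<exists>r is. suffix_array w r \<and> processing_order w ml r is \<and>
        out = findmaxr_loop w r ({t \<in> {1..<length w}. LCP w r t < ml} \<union> {0, length w}) is)"

lemma suffix_array_exists: "\<exists>r. suffix_array w r"
proof -
  let ?n = "length w" and ?f = "\<lambda>i. substr w i (length w)"
  define xs where "xs = sort_key ?f [1..<Suc ?n]"
  define r where "r = (\<lambda>i. xs ! (i - 1))"
  have len: "length xs = ?n" and dist: "distinct xs" and set: "set xs = {1..?n}"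
    by (auto simp: xs_def simp del: upt_Suc)
  have inj: "inj_on ?f {1..?n}"
  proof (rule inj_onI)
    fix i j assume ij: "i \<in> {1..?n}" "j \<in> {1..?n}" "?f i = ?f j"
    have "length (?f i) = length (?f j)" using ij(3) by (rule arg_cong)
    then show "i = j" using ij(1,2) by (auto simp: substr_def simp del: upt_Suc)
  qed
  have sorted: "sorted (map ?f xs)" by (simp add: xs_def)
  have pred: "bij_betw (\<lambda>i. i - 1) {1..?n} {..<?n}"
    by (rule bij_betw_byWitness[where f' = Suc]) auto
  have "bij_betw (\<lambda>i. xs ! i) {..<?n} {1..?n}"
    by (rule bij_betw_nth) (use len dist set in auto)
  with pred have bij: "bij_betw r {1..?n} {1..?n}"
    using bij_betw_trans by (fastforce simp: r_def comp_def)
  moreover have "?f (r i) < ?f (r j)" if "i \<in> {1..?n}" "j \<in> {1..?n}" "i < j" for i j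
  proof -
    have "?f (r i) \<le> ?f (r j)"
      using sorted_nth_mono[OF sorted, of "i - 1" "j - 1"] that len by (simp add: r_def)
    moreover have "r i \<noteq> r j"
      using bij_betw_imp_inj_on[OF bij] that by (metis inj_onD less_irrefl)
    then have "?f (r i) \<noteq> ?f (r j)"
      using inj bij that by (metis (no_types, lifting) bij_betwE inj_onD)
    ultimately show ?thesis by simp
  qed
  ultimately show ?thesis unfolding suffix_array_def by blast
qed

lemma findmaxr_exists: "\<exists>out. findmaxr w ml out"
proof -
  obtain r where r: "suffix_array w r" using suffix_array_exists by blast
  have "processing_order w ml r
      (sort_key (LCP w r) (filter (\<lambda>t. ml \<le> LCP w r t) [1..<length w]))"
    by (auto simp: processing_order_def)
  with r show ?thesis unfolding findmaxr_def by blast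
qed

end

theory Submission
  imports Defs
begin

text \<open>
  The occurrences of a string form an interval \<open>{a..b}\<close> of the suffix array, on which every LCP value
  is at least the length of the string while the values just outside are smaller.  The string is
  right-maximal iff its length is attained as an LCP value in the interval; the first such index
  in processing order is the one whose neighbours in \<open>S\<close> are \<open>a\<close> and \<open>b\<close>, and all later ones see a
  neighbour with the same LCP value.  If the first and the last suffix of the interval are both
  preceded by the letter \<open>c\<close>, then the occurrences of \<open>c # u\<close> again form an interval, whose end points
  are the ranks of these two suffixes prolonged to the left; so \<open>c # u\<close> has as many occurrences as
  \<open>u\<close> iff the two intervals have the same length.
\<close>

section \<open>Occurrences and maximality\<close>

lemma substr_eq_take_drop:
  assumes "1 \<le> i" "i + l - 1 \<le> length w"
  shows "substr w i (i + l - 1) = take l (drop (i - 1) w)"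
  using assms by (auto intro!: nth_equalityI simp: substr_def letter_def simp del: upt_Suc)

lemma substr_eq_drop:
  assumes "1 \<le> i"
  shows "substr w i (length w) = drop (i - 1) w"
  using assms by (auto intro!: nth_equalityI simp: substr_def letter_def simp del: upt_Suc)

text \<open>Turns index arithmetic into a statement about prefixes of suffixes. The upper bound on
  the position becomes implicit: a nonempty prefix forces the suffix to be long enough.\<close>

lemma occurs_at_iff_prefix:
  "occurs_at w u i \<longleftrightarrow> u \<noteq> [] \<and> 1 \<le> i \<and> prefix u (drop (i - 1) w)"
proof -
  have len: "i + length u - 1 \<le> length w" if "1 \<le> i" "prefix u (drop (i - 1) w)" "u \<noteq> []"
    using prefix_length_le[OF that(2)] that by (cases u) auto
  show ?thesis
    using len unfolding occurs_at_def
    by (metis substr_eq_take_drop take_is_prefix prefix_def append_eq_conv_conj)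
qed

lemma occurs_at_range: "occurs_at w u i \<Longrightarrow> 1 \<le> i \<and> i \<le> length w"
  unfolding occurs_at_def by (cases u) auto

lemma finite_occurrences [simp]: "finite (occurrences w u)"
  by (rule finite_subset[of _ "{1..length w}"])
    (auto simp: occurrences_def dest!: occurs_at_range)

lemma drop_pred_eq_Cons:
  assumes "1 \<le> i" "i \<le> length w"
  shows "drop (i - 1) w = letter w i # drop i w"
proof -
  obtain j where "i = Suc j" "j < length w" using assms by (cases i) auto
  then show ?thesis using Cons_nth_drop_Suc[of j w] by (simp add: letter_def)
qed

text \<open>The guard \<open>1 \<le> i\<close> matters: subtraction truncates, so
  \<open>letter w 0\<close> is the first letter of \<open>w\<close> and position 0 could otherwise
  qualify.\<close>

lemma occurs_at_Cons:
  assumes "u \<noteq> []"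
  shows "occurs_at w (c # u) i \<longleftrightarrow> 1 \<le> i \<and> letter w i = c \<and> occurs_at w u (Suc i)"
proof (cases "1 \<le> i \<and> i \<le> length w")
  case True
  then have "drop (i - 1) w = letter w i # drop i w" by (intro drop_pred_eq_Cons) auto
  then show ?thesis using True assms by (auto simp: occurs_at_iff_prefix)
next
  case False
  then show ?thesis using occurs_at_range[of w _ i] occurs_at_range[of w u "Suc i"] by auto
qed

lemma occurrences_append_subset:
  "u \<noteq> [] \<Longrightarrow> occurrences w (u @ v) \<subseteq> occurrences w u"
  by (auto simp: occurrences_def occurs_at_iff_prefix dest: append_prefixD)

lemma Suc_occurrences_Cons_subset:
  "u \<noteq> [] \<Longrightarrow> Suc ` occurrences w (c # u) \<subseteq> occurrences w u"
  by (auto simp: occurrences_def occurs_at_Cons)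

lemma card_occurrences_append_le:
  assumes "u \<noteq> []"
  shows "card (occurrences w (u @ v)) \<le> card (occurrences w u)"
  by (intro card_mono occurrences_append_subset finite_occurrences assms)

lemma card_occurrences_Cons_le:
  assumes "u \<noteq> []"
  shows "card (occurrences w (c # u)) \<le> card (occurrences w u)"
  using card_mono[OF finite_occurrences Suc_occurrences_Cons_subset[OF assms, of w c]]
  by (simp add: card_image)

lemma card_occurrences_prepend_le:
  "u \<noteq> [] \<Longrightarrow> card (occurrences w (v @ u)) \<le> card (occurrences w u)"
proof (induction v)
  case (Cons c v)
  then show ?case using card_occurrences_Cons_le[of "v @ u" w c] by auto
qed simp

text \<open>The occurrence \<open>i\<close> has no \<open>c\<close> in front of it, so shifting the
  occurrences of \<open>c # u\<close> by one misses it and the inclusion is proper.\<close>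

lemma card_occurrences_Cons_less:
  assumes "u \<noteq> []" "i \<in> occurrences w u" "i = 1 \<or> letter w (i - 1) \<noteq> c"
  shows "card (occurrences w (c # u)) < card (occurrences w u)"
proof -
  have "i \<notin> Suc ` occurrences w (c # u)"
    using assms by (auto simp: occurrences_def occurs_at_Cons)
  then have "Suc ` occurrences w (c # u) \<subset> occurrences w u"
    using assms(2) Suc_occurrences_Cons_subset[OF assms(1), of w c] by blast
  from psubset_card_mono[OF finite_occurrences this] show ?thesis by (simp add: card_image)
qed

lemma occurrences_Nil [simp]: "occurrences w [] = {}"
  by (auto simp: occurrences_def occurs_at_def)

text \<open>Counts can only drop when letters are added on either side, and every proper extension
  contains a one-letter extension of \<open>u\<close>; so one-letter extensions decide
  maximality.\<close>

lemma maximal_repeat_iff: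
  "maximal_repeat w u \<longleftrightarrow>
     1 < card (occurrences w u) \<and>
     (\<forall>c. card (occurrences w (u @ [c])) < card (occurrences w u)) \<and>
     (\<forall>c. card (occurrences w (c # u)) < card (occurrences w u))"
  (is "_ \<longleftrightarrow> ?rep \<and> ?right \<and> ?left")
proof (cases ?rep)
  case True
  then have u: "u \<noteq> []" by auto
  show ?thesis
  proof
    assume "maximal_repeat w u"
    moreover have "extension (u @ [c]) u" "extension (c # u) u" for c
      using u unfolding extension_def strict_sublist_def
      by (auto simp: less_le sublist_Cons_right)
    ultimately show "?rep \<and> ?right \<and> ?left" unfolding maximal_repeat_def by blast
  next
    assume max: "?rep \<and> ?right \<and> ?left"
    have "card (occurrences w v) < card (occurrences w u)" if "extension v u" for v
    proof -
      from that obtain xs ys where v: "v = xs @ u @ ys" and ne: "xs \<noteq> [] \<or> ys \<noteq> []"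
        unfolding extension_def strict_sublist_def sublist_def by fastforce
      show ?thesis
      proof (cases ys)
        case (Cons c zs)
        have "card (occurrences w v) \<le> card (occurrences w (u @ [c] @ zs))"
          unfolding v Cons using u card_occurrences_prepend_le[of "u @ c # zs" w xs] by simp
        also have "\<dots> \<le> card (occurrences w (u @ [c]))"
          using u card_occurrences_append_le[of "u @ [c]" w zs] by simp
        finally show ?thesis using max by (meson le_less_trans)
      next
        case Nil
        \<comment> \<open>With nothing added on the right, the letter adjacent to \<open>u\<close>
          is the last one of \<open>xs\<close>.\<close>
        then obtain xs' c where "xs = xs' @ [c]" using ne by (cases xs rule: rev_cases) auto
        then have "card (occurrences w v) \<le> card (occurrences w (c # u))"
          using Nil v card_occurrences_prepend_le[of "c # u" w xs'] by simp
        then show ?thesis using max by (meson le_less_trans)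
      qed
    qed
    then show "maximal_repeat w u" using max by (simp add: maximal_repeat_def)
  qed
qed (simp add: maximal_repeat_def)


section \<open>Intervals of the suffix array\<close>

text \<open>The first letter of \<open>y\<close> is squeezed between two copies of \<open>c\<close>,
  so the tails satisfy the same hypotheses.\<close>

lemma prefix_lex_convex:
  fixes x y z :: "'a::linorder list"
  shows "x \<le> y \<Longrightarrow> y \<le> z \<Longrightarrow> prefix u x \<Longrightarrow> prefix u z \<Longrightarrow> prefix u y"
proof (induction u arbitrary: x y z)
  case (Cons c u)
  from Cons.prems obtain x' z' where "x = c # x'" "z = c # z'" "prefix u x'" "prefix u z'"
    by (auto simp: prefix_def)
  with Cons.prems Cons.IH[of x' _ z'] show ?case by (cases y) auto
qed simp

locale suffix_sorted =
  fixes w :: "'a::linorder list" and r :: "nat \<Rightarrow> nat"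
  assumes suffix_array: "suffix_array w r"
begin

abbreviation n :: nat where "n \<equiv> length w"

abbreviation suffix :: "nat \<Rightarrow> 'a list" where "suffix k \<equiv> drop (r k - 1) w"

text \<open>The occurrences of \<open>u\<close> as suffix array indices, where they are contiguous.
  For the empty string this is the whole array, whereas \<open>occurrences\<close> is empty; hence
  the condition \<open>u \<noteq> []\<close> when translating between the two.\<close>

definition ranks :: "'a list \<Rightarrow> nat set" where
  "ranks u = {k \<in> {1..n}. prefix u (suffix k)}"

lemma bij: "bij_betw r {1..n} {1..n}"
  using suffix_array by (simp add: suffix_array_def)

lemma r_range: "k \<in> {1..n} \<Longrightarrow> 1 \<le> r k \<and> r k \<le> n"
  using bij by (auto dest: bij_betwE)

lemma suffix_less: "i \<in> {1..n} \<Longrightarrow> j \<in> {1..n} \<Longrightarrow> i < j \<Longrightarrow> suffix i < suffix j"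
  using suffix_array r_range by (simp add: suffix_array_def substr_eq_drop)

lemma suffix_le_iff: "i \<in> {1..n} \<Longrightarrow> j \<in> {1..n} \<Longrightarrow> suffix i \<le> suffix j \<longleftrightarrow> i \<le> j"
  by (metis suffix_less leD leI le_less)

lemma occurrences_eq_image_ranks:
  assumes "u \<noteq> []"
  shows "occurrences w u = r ` ranks u"
proof (rule set_eqI)
  fix i
  show "i \<in> occurrences w u \<longleftrightarrow> i \<in> r ` ranks u"
  proof
    assume i: "i \<in> occurrences w u"
    then have "i \<in> r ` {1..n}"
      using bij by (auto simp: occurrences_def bij_betw_def dest: occurs_at_range)
    then show "i \<in> r ` ranks u"
      using i by (auto simp: occurrences_def ranks_def occurs_at_iff_prefix)
  next
    assume "i \<in> r ` ranks u"
    then show "i \<in> occurrences w u"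
      using assms r_range by (auto simp: occurrences_def ranks_def occurs_at_iff_prefix)
  qed
qed

lemma card_occurrences_eq:
  assumes "u \<noteq> []"
  shows "card (occurrences w u) = card (ranks u)"
  unfolding occurrences_eq_image_ranks[OF assms]
  by (rule card_image, rule inj_on_subset[OF bij_betw_imp_inj_on[OF bij]])
    (auto simp: ranks_def)

lemma ranks_convex:
  assumes "i \<in> ranks u" "j \<in> ranks u" "i \<le> k" "k \<le> j"
  shows "k \<in> ranks u"
proof -
  have k: "k \<in> {1..n}" using assms by (auto simp: ranks_def)
  have "suffix i \<le> suffix k" "suffix k \<le> suffix j"
    using assms k by (simp_all add: ranks_def suffix_le_iff del: One_nat_def)
  then show ?thesis
    using prefix_lex_convex assms k by (auto simp: ranks_def)
qed

lemma ranks_interval: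
  assumes "1 < card (ranks u)"
  obtains a b where "ranks u = {a..b}" "1 \<le> a" "a < b" "b \<le> n"
proof -
  let ?a = "Min (ranks u)" and ?b = "Max (ranks u)"
  have fin: "finite (ranks u)" and ne: "ranks u \<noteq> {}" using assms by (auto simp: card_ge_0_finite)
  have mem: "?a \<in> ranks u" "?b \<in> ranks u" using fin ne by auto
  have eq: "ranks u = {?a..?b}"
  proof
    show "ranks u \<subseteq> {?a..?b}" using fin by auto
    show "{?a..?b} \<subseteq> ranks u" using ranks_convex[OF mem] by auto
  qed
  have "1 < card {?a..?b}" using assms eq by argo
  then have "?a < ?b" by simp
  with that eq mem show ?thesis by (simp add: ranks_def)
qed

text \<open>Recovers from the number \<open>LCP w r k\<close> the string it measures, together with
  its universal property.\<close>

lemma LCP_common_prefix: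
  assumes "k \<in> {1..<n}"
  obtains x where "LCP w r k = length x" "prefix x (suffix k)" "prefix x (suffix (Suc k))"
    and "\<And>u. prefix u (suffix k) \<Longrightarrow> prefix u (suffix (Suc k)) \<Longrightarrow> prefix u x"
proof
  let ?X = "{suffix k, suffix (Suc k)}"
  show "LCP w r k = length (Longest_common_prefix ?X)"
    using assms r_range[of k] r_range[of "Suc k"] by (simp add: LCP_def substr_eq_drop)
  show "prefix (Longest_common_prefix ?X) (suffix k)"
    "prefix (Longest_common_prefix ?X) (suffix (Suc k))"
    by (rule Longest_common_prefix_prefix; simp)+
  show "prefix u (Longest_common_prefix ?X)"
    if "prefix u (suffix k)" "prefix u (suffix (Suc k))" for u
    using that by (intro Longest_common_prefix_max_prefix) auto
qed

text \<open>Adjacent suffixes agree on their first \<open>LCP w r k\<close> letters, so membership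
  passes between \<open>k\<close> and \<open>Suc k\<close> in both directions.\<close>

lemma ranks_Suc_iff:
  assumes "k \<in> {1..<n}" "length u \<le> LCP w r k"
  shows "Suc k \<in> ranks u \<longleftrightarrow> k \<in> ranks u"
proof -
  obtain x where x: "LCP w r k = length x" "prefix x (suffix k)" "prefix x (suffix (Suc k))"
    using LCP_common_prefix[OF assms(1)] by blast
  have "prefix u y \<longleftrightarrow> prefix u x" if "prefix x y" for y
    using prefix_length_prefix[of u y x] prefix_order.trans[of u x y] assms(2) x(1) that by auto
  from this[OF x(2)] this[OF x(3)] show ?thesis using assms(1) by (auto simp: ranks_def)
qed

lemma length_le_LCP:
  assumes "k \<in> ranks u" "Suc k \<in> ranks u"
  shows "length u \<le> LCP w r k"
proof -
  have "k \<in> {1..<n}" using assms by (auto simp: ranks_def)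
  then show ?thesis
    by (rule LCP_common_prefix) (use assms in \<open>auto simp: ranks_def intro: prefix_length_le\<close>)
qed

lemma LCP_le_length_suffix:
  assumes "k \<in> {1..<n}"
  shows "LCP w r k \<le> length (suffix k)"
  using LCP_common_prefix[OF assms] prefix_length_le by metis

text \<open>Large LCP values carry membership from \<open>i\<close> through the interval. A member
  outside would, by convexity, put both sides of an end point into \<open>ranks u\<close>, against
  the small LCP value there.\<close>

lemma ranks_eqI:
  assumes ab: "1 \<le> a" "b \<le> n" and i: "i \<in> ranks u" "i \<in> {a..b}"
    and inside: "\<And>t. t \<in> {a..<b} \<Longrightarrow> length u \<le> LCP w r t"
    and below: "a = 1 \<or> LCP w r (a - 1) < length u"
    and above: "b = n \<or> LCP w r b < length u"
  shows "ranks u = {a..b}"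
proof
  have up: "k \<in> ranks u \<longleftrightarrow> a \<in> ranks u" if "a \<le> k" "k \<le> b" for k
    using that
  proof (induction k rule: dec_induct)
    case (step m)
    then show ?case using ranks_Suc_iff[of m u] inside[of m] ab by auto
  qed simp
  show "{a..b} \<subseteq> ranks u"
  proof
    fix k assume "k \<in> {a..b}"
    then show "k \<in> ranks u" using i up[of i] up[of k] by simp
  qed
  show "ranks u \<subseteq> {a..b}"
  proof
    fix k assume k: "k \<in> ranks u"
    have kn: "1 \<le> k" "k \<le> n" using k by (auto simp: ranks_def)
    have "a \<le> k"
    proof (rule ccontr)
      assume "\<not> a \<le> k"
      \<comment> \<open>Here \<open>k \<le> a - 1 < i\<close>, so convexity applies to
        \<open>a - 1\<close>.\<close>
      then have "a - 1 \<in> ranks u" "a \<in> ranks u" "a \<noteq> 1"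
        using k i up[of i] kn ranks_convex[of k u i "a - 1"] by auto
      then show False using length_le_LCP[of "a - 1" u] below ab by auto
    qed
    moreover have "k \<le> b"
    proof (rule ccontr)
      assume "\<not> k \<le> b"
      then have "b \<in> ranks u" "Suc b \<in> ranks u" "b \<noteq> n"
        using k i kn ranks_convex[of i u k b] ranks_convex[of i u k "Suc b"] by auto
      then show False using length_le_LCP[of b u] above by auto
    qed
    ultimately show "k \<in> {a..b}" by simp
  qed
qed

lemma ranks_bounds:
  assumes "ranks u = {a..b}" "a < b"
  shows "1 \<le> a" "b \<le> n"
proof -
  have "a \<in> ranks u" "b \<in> ranks u" using assms by auto
  then show "1 \<le> a" "b \<le> n" by (simp_all add: ranks_def)
qed

text \<open>The converse of \<open>ranks_eqI\<close>: an LCP value of at least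
  \<open>length u\<close> at an end point would let membership leak out of the interval.\<close>

lemma ranks_eqD:
  assumes "ranks u = {a..b}" "a < b"
  shows "t \<in> {a..<b} \<Longrightarrow> length u \<le> LCP w r t"
    and "a = 1 \<or> LCP w r (a - 1) < length u"
    and "b = n \<or> LCP w r b < length u"
proof -
  have ab: "1 \<le> a" "b \<le> n" using ranks_bounds assms by auto
  show "length u \<le> LCP w r t" if "t \<in> {a..<b}"
    using that assms by (intro length_le_LCP) auto
  show "a = 1 \<or> LCP w r (a - 1) < length u"
    using ranks_Suc_iff[of "a - 1" u] assms ab by fastforce
  show "b = n \<or> LCP w r b < length u"
    using ranks_Suc_iff[of b u] assms ab by fastforce
qed


section \<open>Right and left maximality\<close>

text \<open>If all inner LCP values exceed \<open>length u\<close>, all suffixes in the interval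
  continue with the same letter \<open>c\<close>, and \<open>u @ [c]\<close> is as frequent as
  \<open>u\<close>. If equality holds at \<open>t\<close>, no letter continues \<open>u\<close> at
  both \<open>t\<close> and \<open>Suc t\<close>.\<close>

lemma right_maximal_iff:
  assumes u: "u \<noteq> []" and ranks: "ranks u = {a..b}" and ab: "a < b"
  shows "(\<forall>c. card (occurrences w (u @ [c])) < card (occurrences w u)) \<longleftrightarrow>
         (\<exists>t\<in>{a..<b}. LCP w r t = length u)"
proof
  have bounds: "1 \<le> a" "b \<le> n" using ranks_bounds ranks ab by auto
  assume less: "\<forall>c. card (occurrences w (u @ [c])) < card (occurrences w u)"
  show "\<exists>t\<in>{a..<b}. LCP w r t = length u"
  proof (rule ccontr)
    assume "\<not> ?thesis"
    then have gt: "length u < LCP w r t" if "t \<in> {a..<b}" for t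
      using ranks_eqD(1)[OF ranks ab that] that by force
    have a: "a \<in> ranks u" using ranks ab by simp
    then obtain ys where ys: "suffix a = u @ ys" by (auto simp: ranks_def prefix_def)
    \<comment> \<open>The LCP value at \<open>a\<close> bounds this suffix from below, so a letter
      \<open>c\<close> follows \<open>u\<close> in it.\<close>
    have "length u < length (suffix a)"
      using gt[of a] LCP_le_length_suffix[of a] ab bounds by fastforce
    then obtain c zs where "ys = c # zs" using ys by (cases ys) auto
    then have "a \<in> ranks (u @ [c])" using a ys by (auto simp: ranks_def)
    then have "ranks (u @ [c]) = {a..b}"
      using bounds ab gt ranks_eqD(2,3)[OF ranks ab]
      by (intro ranks_eqI[of a b a]) (auto simp: Suc_le_eq)
    then have "card (occurrences w (u @ [c])) = card (occurrences w u)"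
      using u ranks by (simp add: card_occurrences_eq)
    with less show False by (metis less_irrefl)
  qed
next
  assume "\<exists>t\<in>{a..<b}. LCP w r t = length u"
  then obtain t where t: "t \<in> {a..<b}" "LCP w r t = length u" by blast
  show "\<forall>c. card (occurrences w (u @ [c])) < card (occurrences w u)"
  proof
    fix c
    have "ranks (u @ [c]) \<subseteq> ranks u" by (auto simp: ranks_def dest: append_prefixD)
    moreover have "\<not> (t \<in> ranks (u @ [c]) \<and> Suc t \<in> ranks (u @ [c]))"
      using length_le_LCP[of t "u @ [c]"] t by auto
    ultimately have "ranks (u @ [c]) \<subset> ranks u" using t ranks by auto
    moreover have "finite (ranks u)" using ranks by simp
    ultimately show "card (occurrences w (u @ [c])) < card (occurrences w u)"
      using u psubset_card_mono by (auto simp: card_occurrences_eq)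
  qed
qed

section \<open>Prolonging suffixes to the left\<close>

lemma inverse_array_props:
  assumes "i \<in> {1..n}"
  shows "inverse_array w r i \<in> {1..n}" "r (inverse_array w r i) = i"
proof -
  have "i \<in> r ` {1..n}" using bij assms by (simp add: bij_betw_def)
  then show "inverse_array w r i \<in> {1..n}" "r (inverse_array w r i) = i"
    unfolding inverse_array_def by (rule inv_into_into, rule f_inv_into_f)
qed

text \<open>Putting the same letter in front preserves the order of suffixes, so \<open>l\<close>
  and \<open>h\<close> are extreme among the suffixes starting with \<open>c # u\<close>.\<close>

lemma ranks_Cons:
  fixes a b :: nat
  defines "l \<equiv> inverse_array w r (r a - 1)" and "h \<equiv> inverse_array w r (r b - 1)"
  assumes u: "u \<noteq> []" and ranks: "ranks u = {a..b}" and ab: "a < b"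
    and not1: "r a \<noteq> 1" "r b \<noteq> 1"
    and letters: "letter w (r a - 1) = c" "letter w (r b - 1) = c"
  shows "ranks (c # u) = {l..h}" "l \<le> h"
proof -
  have pred: "inverse_array w r (r k - 1) \<in> {1..n} \<and>
      suffix (inverse_array w r (r k - 1)) = c # suffix k"
    if "k \<in> {1..n}" "r k \<noteq> 1" "letter w (r k - 1) = c" for k
  proof -
    have rk: "r k - 1 \<in> {1..n}" using r_range[OF that(1)] that(2) by auto
    then have "drop (r k - 1 - 1) w = c # suffix k"
      using drop_pred_eq_Cons[of "r k - 1" w] that(3) by simp
    with inverse_array_props[OF rk(1)] show ?thesis by simp
  qed
  have mem: "a \<in> ranks u" "b \<in> ranks u" using ranks ab by auto
  then have ran: "a \<in> {1..n}" "b \<in> {1..n}" by (auto simp: ranks_def)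
  have l: "l \<in> {1..n}" "suffix l = c # suffix a"
    using pred[OF ran(1) not1(1) letters(1)] by (auto simp: l_def)
  have h: "h \<in> {1..n}" "suffix h = c # suffix b"
    using pred[OF ran(2) not1(2) letters(2)] by (auto simp: h_def)
  have "suffix l \<le> suffix h" using l h suffix_le_iff ran ab by simp
  then show "l \<le> h" using suffix_le_iff l(1) h(1) by blast
  show "ranks (c # u) = {l..h}"
  proof
    have "l \<in> ranks (c # u)" "h \<in> ranks (c # u)" using l h mem by (auto simp: ranks_def)
    then show "{l..h} \<subseteq> ranks (c # u)" using ranks_convex[of l "c # u" h] by auto
    show "ranks (c # u) \<subseteq> {l..h}"
    proof
      fix m assume m: "m \<in> ranks (c # u)"
      then have m_ran: "m \<in> {1..n}" by (auto simp: ranks_def)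
      have "r m \<in> occurrences w (c # u)"
        using m occurrences_eq_image_ranks[of "c # u"] by auto
      then have "letter w (r m) = c" "Suc (r m) \<in> occurrences w u"
        using u by (auto simp: occurrences_def occurs_at_Cons)
      \<comment> \<open>\<open>k\<close> is the rank of the suffix that remains when
        \<open>suffix m\<close> loses its first letter; it lies between \<open>a\<close> and
        \<open>b\<close>.\<close>
      moreover from this obtain k where k: "k \<in> ranks u" "r k = Suc (r m)"
        using occurrences_eq_image_ranks[OF u] by auto
      ultimately have "suffix m = c # suffix k"
        using r_range[OF m_ran] drop_pred_eq_Cons[of "r m" w] by simp
      moreover have "k \<in> {1..n}" "a \<le> k" "k \<le> b" using k ranks by (auto simp: ranks_def)
      ultimately have "suffix l \<le> suffix m" "suffix m \<le> suffix h"
        using suffix_le_iff[of a k] suffix_le_iff[of k b] ran l h by simp_all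
      then show "m \<in> {l..h}" using suffix_le_iff l(1) h(1) m_ran by auto
    qed
  qed
qed

text \<open>If an end suffix has no preceding letter, or the two letters differ, every
  \<open>c\<close> fails to precede one of the two end occurrences. Otherwise only the common letter
  is critical, and \<open>ranks_Cons\<close> reduces it to comparing interval lengths.\<close>

lemma left_maximal_iff:
  assumes u: "u \<noteq> []" and ranks: "ranks u = {a..b}" and ab: "a < b"
  shows "(\<forall>c. card (occurrences w (c # u)) < card (occurrences w u)) \<longleftrightarrow>
         r a = 1 \<or> r b = 1 \<or> letter w (r a - 1) \<noteq> letter w (r b - 1) \<or>
         int (inverse_array w r (r b - 1)) - int (inverse_array w r (r a - 1)) \<noteq> int b - int a"
    (is "?max \<longleftrightarrow> ?test")
proof (cases "r a = 1 \<or> r b = 1 \<or> letter w (r a - 1) \<noteq> letter w (r b - 1)")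
  case True
  have "r a \<in> occurrences w u" "r b \<in> occurrences w u"
    using ranks ab by (auto simp: occurrences_eq_image_ranks[OF u])
  then have ?max using True card_occurrences_Cons_less[OF u] by metis
  with True show ?thesis by blast
next
  case False
  let ?c = "letter w (r a - 1)"
  let ?l = "inverse_array w r (r a - 1)" and ?h = "inverse_array w r (r b - 1)"
  have eq: "ranks (?c # u) = {?l..?h}" and le: "?l \<le> ?h"
    using False ranks_Cons[OF u ranks ab, of ?c] by auto
  have card: "card (occurrences w (?c # u)) = Suc ?h - ?l" "card (occurrences w u) = Suc b - a"
    using u eq ranks by (auto simp: card_occurrences_eq)
  have "?max \<longleftrightarrow> card (occurrences w (?c # u)) < card (occurrences w u)"
  proof
    assume less: "card (occurrences w (?c # u)) < card (occurrences w u)"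
    \<comment> \<open>Any letter other than \<open>?c\<close> fails at the occurrence
      \<open>r a\<close>.\<close>
    have "r a \<in> occurrences w u" using ranks ab by (auto simp: occurrences_eq_image_ranks[OF u])
    then show ?max using card_occurrences_Cons_less[OF u] less by metis
  qed blast
  also have "\<dots> \<longleftrightarrow> int ?h - int ?l \<noteq> int b - int a"
    \<comment> \<open>Counts never grow, so being smaller means being different;
      \<open>?l \<le> ?h\<close> and \<open>a < b\<close> keep the natural subtractions from
      truncating.\<close>
    using card_occurrences_Cons_le[OF u, of w ?c] le ab unfolding card by linarith
  finally show ?thesis using False by blast
qed

lemma maximal_repeat_ranks_iff:
  assumes "u \<noteq> []" "ranks u = {a..b}" "a < b"
  shows "maximal_repeat w u \<longleftrightarrow>
         (\<exists>t\<in>{a..<b}. LCP w r t = length u) \<and>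
         (r a = 1 \<or> r b = 1 \<or> letter w (r a - 1) \<noteq> letter w (r b - 1) \<or>
          int (inverse_array w r (r b - 1)) - int (inverse_array w r (r a - 1)) \<noteq> int b - int a)"
proof -
  have "1 < card (occurrences w u)" using assms by (simp add: card_occurrences_eq)
  then show ?thesis
    unfolding maximal_repeat_iff right_maximal_iff[OF assms] left_maximal_iff[OF assms] by blast
qed


section \<open>The main loop\<close>

text \<open>\<open>lower S i\<close> and \<open>upper S i\<close> are the neighbours
  \<open>p\<^sub>i\<close> and \<open>n\<^sub>i\<close> computed in state \<open>S\<close>.\<close>

definition lower :: "nat set \<Rightarrow> nat \<Rightarrow> nat" where
  "lower S i = Max {j \<in> S. j < i} + 1"

definition upper :: "nat set \<Rightarrow> nat \<Rightarrow> nat" where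
  "upper S i = Min {j \<in> S. i < j}"

definition report :: "nat set \<Rightarrow> nat \<Rightarrow> 'a list \<times> nat list" where
  "report S i =
     (substr w (r i) (r i + LCP w r i - 1), map r [lower S i..<Suc (upper S i)])"

lemma findmaxr_loop_Cons:
  "findmaxr_loop w r S (i # is) =
     (if reportable w r i (lower S i) (upper S i) then [report S i] else []) @
     findmaxr_loop w r (insert i S) is"
  by (simp add: lower_def upper_def report_def Let_def)

text \<open>Unrolls the recursion: when \<open>i\<close> is processed, the state is the initial set
  together with the indices \<open>pre\<close> already handled.\<close>

lemma set_findmaxr_loop:
  "x \<in> set (findmaxr_loop w r S is) \<longleftrightarrow>
     (\<exists>pre i post. is = pre @ i # post \<and>
        reportable w r i (lower (S \<union> set pre) i) (upper (S \<union> set pre) i) \<and>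
        x = report (S \<union> set pre) i)"
proof (induction "is" arbitrary: S)
  case (Cons i "is")
  define Q where "Q T j \<longleftrightarrow>
      reportable w r j (lower T j) (upper T j) \<and> x = report T j" for T j
  have "(\<exists>pre j post. i # is = pre @ j # post \<and> Q (S \<union> set pre) j) \<longleftrightarrow>
      Q S i \<or> (\<exists>pre j post. is = pre @ j # post \<and> Q (insert i S \<union> set pre) j)"
    (is "?lhs \<longleftrightarrow> ?rhs")
  proof
    assume ?lhs
    then obtain pre j post where "i # is = pre @ j # post" "Q (S \<union> set pre) j" by blast
    then show ?rhs by (cases pre) auto
  next
    assume ?rhs
    then show ?lhs
    proof
      assume "Q S i"
      then show ?lhs by (intro exI[of _ "[]"] exI[of _ i] exI[of _ "is"]) simp
    next
      assume "\<exists>pre j post. is = pre @ j # post \<and> Q (insert i S \<union> set pre) j"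
      then obtain pre j post where "is = pre @ j # post" "Q (insert i S \<union> set pre) j" by blast
      then show ?lhs by (intro exI[of _ "i # pre"] exI[of _ j] exI[of _ post]) simp
    qed
  qed
  moreover have "x \<in> set (findmaxr_loop w r S (i # is)) \<longleftrightarrow>
      Q S i \<or> x \<in> set (findmaxr_loop w r (insert i S) is)"
    unfolding findmaxr_loop_Cons Q_def by auto
  ultimately show ?case unfolding Cons.IH Q_def by argo
qed simp

section \<open>Lengths and order of the reports\<close>

lemma length_substr_LCP:
  assumes "i \<in> {1..<n}"
  shows "substr w (r i) (r i + LCP w r i - 1) = take (LCP w r i) (suffix i)"
    and "length (substr w (r i) (r i + LCP w r i - 1)) = LCP w r i"
proof -
  have "1 \<le> r i" "r i + LCP w r i - 1 \<le> n"
    using r_range[of i] LCP_le_length_suffix[OF assms] assms by auto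
  then show "substr w (r i) (r i + LCP w r i - 1) = take (LCP w r i) (suffix i)"
    by (rule substr_eq_take_drop)
  then show "length (substr w (r i) (r i + LCP w r i - 1)) = LCP w r i"
    using LCP_le_length_suffix[OF assms] by simp
qed

text \<open>Each reported string is as long as the LCP value of its index, and the indices come
  sorted by that value.\<close>

lemma sorted_findmaxr_loop:
  assumes "sorted (map (LCP w r) is)" "set is \<subseteq> {1..<n}"
  shows "sorted (map (\<lambda>(u, ps). length u) (findmaxr_loop w r S is))"
  using assms
proof (induction "is" arbitrary: S)
  case (Cons i "is")
  have "LCP w r i \<le> length (fst x)" if "x \<in> set (findmaxr_loop w r (insert i S) is)" for x
  proof -
    from that obtain j T where "j \<in> set is" "x = report T j"
      unfolding set_findmaxr_loop by (metis in_set_conv_decomp)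
    then show ?thesis using Cons.prems length_substr_LCP(2)[of j] by (auto simp: report_def)
  qed
  moreover have "length (fst (report S i)) = LCP w r i"
    using Cons.prems length_substr_LCP(2)[of i] by (simp add: report_def)
  ultimately show ?case
    using Cons unfolding findmaxr_loop_Cons by (auto simp: case_prod_unfold)
qed simp

section \<open>Neighbours of an index in a finite set\<close>

text \<open>The sentinel 0 keeps the set under \<open>Max\<close> nonempty; \<open>m\<close> does
  the same for \<open>Min\<close> in \<open>upper_props\<close>.\<close>

lemma lower_props:
  assumes "finite S" "0 \<in> S" "0 < i"
  shows "lower S i - 1 \<in> S" "1 \<le> lower S i" "lower S i \<le> i"
    and "\<And>j. lower S i \<le> j \<Longrightarrow> j < i \<Longrightarrow> j \<notin> S"
proof -
  let ?A = "{j \<in> S. j < i}"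
  have A: "finite ?A" "?A \<noteq> {}" using assms by auto
  from Max_in[OF this] show "lower S i - 1 \<in> S" "1 \<le> lower S i" "lower S i \<le> i"
    by (auto simp: lower_def)
  show "j \<notin> S" if "lower S i \<le> j" "j < i" for j
    using Max_ge[OF A(1), of j] that unfolding lower_def by fastforce
qed

lemma upper_props:
  assumes "finite S" "m \<in> S" "i < m"
  shows "upper S i \<in> S" "i < upper S i" "upper S i \<le> m"
    and "\<And>j. i < j \<Longrightarrow> j < upper S i \<Longrightarrow> j \<notin> S"
proof -
  let ?A = "{j \<in> S. i < j}"
  have A: "finite ?A" "?A \<noteq> {}" using assms by auto
  from Min_in[OF this] show "upper S i \<in> S" "i < upper S i" by (auto simp: upper_def)
  show "upper S i \<le> m" using Min_le[OF A(1), of m] assms by (auto simp: upper_def)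
  show "j \<notin> S" if "i < j" "j < upper S i" for j
    using Min_le[OF A(1), of j] that unfolding upper_def by fastforce
qed

lemma lower_eqI:
  assumes "finite S" "1 \<le> a" "a - 1 \<in> S" "a \<le> i" "\<And>j. a \<le> j \<Longrightarrow> j < i \<Longrightarrow> j \<notin> S"
  shows "lower S i = a"
proof -
  have "Max {j \<in> S. j < i} = a - 1"
  proof (rule Max_eqI)
    fix j assume "j \<in> {j \<in> S. j < i}"
    then have "\<not> a \<le> j" using assms(5) by blast
    then show "j \<le> a - 1" by simp
  qed (use assms in auto)
  then show ?thesis using assms by (simp add: lower_def)
qed

lemma upper_eqI:
  assumes "finite S" "b \<in> S" "i < b" "\<And>j. i < j \<Longrightarrow> j < b \<Longrightarrow> j \<notin> S"
  shows "upper S i = b"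
  unfolding upper_def using assms by (intro Min_eqI) (auto simp: not_less[symmetric])

section \<open>Soundness and completeness of the reports for \<open>ml = 1\<close>\<close>

definition start :: "nat set" where
  "start = {t \<in> {1..<n}. LCP w r t < 1} \<union> {0, n}"

lemma finite_start [simp]: "finite start"
  by (simp add: start_def)

text \<open>The neighbours enclose only indices of LCP value at least that of \<open>i\<close>, and
  the first two conditions of the test make the values at the ends strictly smaller; so
  \<open>ranks_eqI\<close> applies. The last condition is left maximality.\<close>

lemma report_sound:
  assumes order: "processing_order w 1 r (pre @ i # post)"
    and reportable: "reportable w r i (lower (start \<union> set pre) i) (upper (start \<union> set pre) i)"
  shows "maximal_repeat w (fst (report (start \<union> set pre) i))"
    and "set (snd (report (start \<union> set pre) i)) = occurrences w (fst (report (start \<union> set pre) i))"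
proof -
  let ?S = "start \<union> set pre" and ?L = "LCP w r i"
  define a b where "a = lower ?S i" and "b = upper ?S i"
  define u where "u = substr w (r i) (r i + ?L - 1)"
  have set_eq: "set pre \<union> {i} \<union> set post = {t \<in> {1..<n}. 1 \<le> LCP w r t}"
    using order by (auto simp: processing_order_def)
  have sorted: "\<And>j. j \<in> set pre \<Longrightarrow> LCP w r j \<le> ?L" "\<And>j. j \<in> set post \<Longrightarrow> ?L \<le> LCP w r j"
    using order by (auto simp: processing_order_def sorted_append)
  have i: "i \<in> {1..<n}" "1 \<le> ?L" using set_eq by auto
  have a: "a - 1 \<in> ?S" "1 \<le> a" "a \<le> i" "\<And>j. a \<le> j \<Longrightarrow> j < i \<Longrightarrow> j \<notin> ?S"
    unfolding a_def using i by (intro lower_props; simp add: start_def)+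
  have b: "b \<in> ?S" "i < b" "b \<le> n" "\<And>j. i < j \<Longrightarrow> j < b \<Longrightarrow> j \<notin> ?S"
    unfolding b_def using i by (intro upper_props[where m = n]; simp add: start_def)+
  \<comment> \<open>An inner index other than \<open>i\<close> is not in the state, hence still
    waits in \<open>post\<close>.\<close>
  have inside: "?L \<le> LCP w r t" if "t \<in> {a..<b}" for t
  proof (cases "t = i")
    case False
    then have "t \<notin> ?S" using a(4) b(4) that by (cases t i rule: linorder_cases) auto
    moreover from this have "t \<in> {1..<n}" "1 \<le> LCP w r t"
      using that a(2) b(3) by (auto simp: start_def)
    ultimately have "t \<in> set post" using set_eq False by blast
    then show ?thesis by (rule sorted)
  qed simp
  \<comment> \<open>Members of the state were processed earlier or have LCP value 0; the sentinels 0
    and \<open>n\<close> carry no LCP value.\<close>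
  have low: "LCP w r j \<le> ?L" if "j \<in> ?S" "j \<noteq> 0" "j \<noteq> n" for j
    using that sorted(1) i by (auto simp: start_def)
  have neq: "a = 1 \<or> LCP w r (a - 1) \<noteq> ?L" "b = n \<or> LCP w r b \<noteq> ?L"
    using reportable unfolding reportable_def a_def b_def by blast+
  have below: "a = 1 \<or> LCP w r (a - 1) < ?L"
  proof (cases "a = 1")
    case False
    then have "a - 1 \<noteq> 0" "a - 1 \<noteq> n" using a(2,3) i by auto
    with low[OF a(1)] neq(1) False show ?thesis by linarith
  qed simp
  have above: "b = n \<or> LCP w r b < ?L"
    using low[OF b(1)] neq(2) b(2) by linarith
  have u: "u = take ?L (suffix i)" "length u = ?L"
    unfolding u_def by (rule length_substr_LCP[OF i(1)])+
  then have "i \<in> ranks u" "u \<noteq> []" using i by (auto simp: ranks_def take_is_prefix)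
  then have ranks: "ranks u = {a..b}"
    using a b u inside below above by (intro ranks_eqI[of a b i]) auto
  have report: "report ?S i = (u, map r [a..<Suc b])" by (simp add: report_def u_def a_def b_def)
  \<comment> \<open>Right maximality is witnessed by \<open>i\<close> itself.\<close>
  have "\<exists>t\<in>{a..<b}. LCP w r t = length u" using u a b by auto
  then show "maximal_repeat w (fst (report ?S i))"
    using maximal_repeat_ranks_iff[OF \<open>u \<noteq> []\<close> ranks] a b reportable
    unfolding report reportable_def a_def[symmetric] b_def[symmetric] by auto
  show "set (snd (report ?S i)) = occurrences w (fst (report ?S i))"
    unfolding report using occurrences_eq_image_ranks[OF \<open>u \<noteq> []\<close>] ranks
    by (auto simp del: upt_Suc)
qed

text \<open>The reporting index is the first one processed among the inner indices with LCP value
  \<open>length u\<close>. By then every index of smaller value is in the state and no inner index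
  is, so the neighbours are exactly \<open>a\<close> and \<open>b\<close>.\<close>

lemma report_complete:
  assumes order: "processing_order w 1 r is" and max: "maximal_repeat w u"
  shows "\<exists>pre i post. is = pre @ i # post \<and>
    reportable w r i (lower (start \<union> set pre) i) (upper (start \<union> set pre) i) \<and>
    fst (report (start \<union> set pre) i) = u"
proof -
  have card: "1 < card (occurrences w u)" using max by (simp add: maximal_repeat_def)
  then have u: "u \<noteq> []" by auto
  then obtain a b where ranks: "ranks u = {a..b}" and ab: "1 \<le> a" "a < b" "b \<le> n"
    using card ranks_interval[of u] card_occurrences_eq by metis
  note ranksD = ranks_eqD[OF ranks ab(2)]
  let ?P = "\<lambda>t. t \<in> {a..<b} \<and> LCP w r t = length u"
  have test: "\<exists>t. ?P t"
    "r a = 1 \<or> r b = 1 \<or> letter w (r a - 1) \<noteq> letter w (r b - 1) \<or>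
     int (inverse_array w r (r b - 1)) - int (inverse_array w r (r a - 1)) \<noteq> int b - int a"
    using maximal_repeat_ranks_iff[OF u ranks ab(2)] max by auto
  have len: "1 \<le> length u" using u by (cases u) auto
  have set_is: "set is = {t \<in> {1..<n}. 1 \<le> LCP w r t}"
    using order by (simp add: processing_order_def)
  have "\<exists>t\<in>set is. ?P t" using test(1) len ab set_is by auto
  then obtain pre i post where split: "is = pre @ i # post" and i: "?P i"
    and first: "\<And>t. t \<in> set pre \<Longrightarrow> \<not> ?P t"
    using split_list_first_prop[of "is" ?P] by blast
  have sorted: "\<And>j. j \<in> set pre \<Longrightarrow> LCP w r j \<le> length u"
    "\<And>j. j \<in> set post \<Longrightarrow> length u \<le> LCP w r j"
    using order i unfolding split by (auto simp: processing_order_def sorted_append)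
  let ?S = "start \<union> set pre"
  have smaller: "t \<in> ?S" if "t \<in> {1..<n}" "LCP w r t < length u" for t
  proof (cases "LCP w r t < 1")
    case False
    then have "t \<in> set is" using that set_is by auto
    then show ?thesis using that i sorted(2)[of t] by (auto simp: split)
  qed (use that in \<open>simp add: start_def\<close>)
  \<comment> \<open>An inner index in \<open>pre\<close> would have LCP value exactly
    \<open>length u\<close>, against the choice of \<open>i\<close> as first.\<close>
  have inside: "t \<notin> ?S" if "t \<in> {a..<b}" for t
    using that ranksD(1)[OF that] first[of t] sorted(1)[of t] len ab by (auto simp: start_def)
  have "a - 1 \<in> ?S"
  proof (cases "a = 1")
    case False
    then have "a - 1 \<in> {1..<n}" using ab by auto
    then show ?thesis using smaller ranksD(2) False by blast
  qed (simp add: start_def)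
  then have lower: "lower ?S i = a" using i ab inside by (intro lower_eqI) auto
  have "b \<in> ?S"
  proof (cases "b = n")
    case False
    then have "b \<in> {1..<n}" using ab by auto
    then show ?thesis using smaller ranksD(3) False by blast
  qed (simp add: start_def)
  then have upper: "upper ?S i = b" using i ab inside by (intro upper_eqI) auto
  \<comment> \<open>The values at the ends are below \<open>length u\<close>, which is the value at
    \<open>i\<close>, so they differ from it.\<close>
  have "reportable w r i a b"
    using test(2) ranksD(2,3) i unfolding reportable_def by fastforce
  moreover have "i \<in> ranks u" using i ranks by simp
  then have "u = take (LCP w r i) (suffix i)" using i by (auto simp: ranks_def prefix_def)
  then have "fst (report ?S i) = u"
    using length_substr_LCP(1)[of i] i ab by (simp add: report_def)
  ultimately show ?thesis using split lower upper by auto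
qed

end

theorem theorem2:
  fixes w :: "'a::linorder list" and out :: "('a list \<times> nat list) list"
  assumes "findmaxr w 1 out"
  shows "(\<forall>(u, ps) \<in> set out. maximal_repeat w u \<and> set ps = occurrences w u) \<and>
         (\<forall>u. maximal_repeat w u \<longrightarrow> (\<exists>ps. (u, ps) \<in> set out)) \<and>
         sorted (map (\<lambda>(u, ps). length u) out)"
proof -
  from assms obtain r "is" where sa: "suffix_array w r" and order: "processing_order w 1 r is"
    and out: "out = findmaxr_loop w r ({t \<in> {1..<length w}. LCP w r t < 1} \<union> {0, length w}) is"
    unfolding findmaxr_def by blast
  interpret suffix_sorted w r by unfold_locales (rule sa)
  have out: "out = findmaxr_loop w r start is" by (simp add: out start_def)
  have "maximal_repeat w u \<and> set ps = occurrences w u" if "(u, ps) \<in> set out" for u ps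
  proof -
    from that obtain pre i post where "is = pre @ i # post"
      "reportable w r i (lower (start \<union> set pre) i) (upper (start \<union> set pre) i)"
      "(u, ps) = report (start \<union> set pre) i"
      unfolding out set_findmaxr_loop by blast
    then show ?thesis using report_sound[of pre i post] order by (metis fst_conv snd_conv)
  qed
  moreover have "\<exists>ps. (u, ps) \<in> set out" if "maximal_repeat w u" for u
    using report_complete[OF order that] unfolding out set_findmaxr_loop by (metis prod.collapse)
  moreover have "sorted (map (\<lambda>(u, ps). length u) out)"
  proof -
    have "sorted (map (LCP w r) is)" "set is \<subseteq> {1..<n}"
      using order unfolding processing_order_def by blast+
    then show ?thesis unfolding out by (rule sorted_findmaxr_loop)
  qed
  ultimately show ?thesis by blast
qed

end
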